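(* Let $C$ be the $n\times n$ affine Cartan matrix of type $X$, where $X$ is one of $A_{n-1}^{(1)}$ ($n\ge 3$), $B_{n-1}^{(1)}$ ($n\ge 4$), $C_{n-1}^{(1)}$ ($n\ge 3$), $D_{n-1}^{(1)}$ ($n\ge 5$). Put $A=2I-C$ and $q_n(x)=\det(2xI+A)$. Let $T_k(x)$ denote the $k$-th Chebyshev polynomial of the first kind. Then \begin{itemize} \item for $X=A_{n-1}^{(1)}$: $q_n(x)=2\left(T_n(x)+(-1)^{n-1}\right)$; \item for $X=B_{n-1}^{(1)}$: $q_n(x)=2\left(T_n(x)-T_{n-4}(x)\right)$; \item for $X=C_{n-1}^{(1)}$: $q_n(x)=2\left(T_n(x)-T_{n-2}(x)\right)$; \item for $X=D_{n-1}^{(1)}$: $q_n(x)=8x^2\left(T_{n-2}(x)-T_{n-4}(x)\right)$. \end{itemize}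
   Context: The Chebyshev polynomials of the first kind are defined by $T_0=1$, $T_1=x$, $T_{k+1}=2xT_k-T_{k-1}$. The $n\times n$ affine Cartan matrices $C=(C_{i,j})_{1\le i,j\le n}$ are as follows; in every case $C_{i,i}=2$ and all off-diagonal entries not listed are $0$. Type $A_{n-1}^{(1)}$: $C_{i,i+1}=C_{i+1,i}=-1$ for $1\le i\le n-1$, and $C_{1,n}=C_{n,1}=-1$. Type $B_{n-1}^{(1)}$: $C_{1,3}=C_{3,1}=-1$; $C_{i,i+1}=C_{i+1,i}=-1$ for $2\le i\le n-2$; $C_{n-1,n}=-2$, $C_{n,n-1}=-1$. Type $C_{n-1}^{(1)}$: $C_{1,2}=-2$, $C_{2,1}=-1$; $C_{i,i+1}=C_{i+1,i}=-1$ for $2\le i\le n-2$; $C_{n-1,n}=-1$, $C_{n,n-1}=-2$. Type $D_{n-1}^{(1)}$: $C_{1,3}=C_{3,1}=-1$; $C_{i,i+1}=C_{i+1,i}=-1$ for $2\le i\le n-2$; $C_{n-2,n}=C_{n,n-2}=-1$. *)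

theory Defs
  imports "Jordan_Normal_Form.Determinant"
begin

fun cheb_T :: "nat \<Rightarrow> int poly" where
  "cheb_T 0 = 1"
| "cheb_T (Suc 0) = [:0, 1:]"
| "cheb_T (Suc (Suc k)) = 2 * [:0, 1:] * cheb_T (Suc k) - cheb_T k"

text \<open>The constructors stand for the affine types $A_{n-1}^{(1)}$, $B_{n-1}^{(1)}$,
  $C_{n-1}^{(1)}$ and $D_{n-1}^{(1)}$; the size \<open>n\<close> of the matrix is a separate argument.\<close>

datatype affine_type = AffA | AffB | AffC | AffD

text \<open>Entries are indexed by \<open>1 \<le> i, j \<le> n\<close>. The branches for off-diagonal
  entries do not overlap when \<open>n\<close> is at least 3, 4, 3, 5 for the four types respectively.\<close>

fun affine_cartan_entry :: "affine_type \<Rightarrow> nat \<Rightarrow> nat \<Rightarrow> nat \<Rightarrow> int" where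
  "affine_cartan_entry AffA n i j =
    (if i = j then 2
     else if (1 \<le> i \<and> i \<le> n - 1 \<and> j = i + 1) \<or> (1 \<le> j \<and> j \<le> n - 1 \<and> i = j + 1) then - 1
     else if (i = 1 \<and> j = n) \<or> (i = n \<and> j = 1) then - 1
     else 0)"
| "affine_cartan_entry AffB n i j =
    (if i = j then 2
     else if (i = 1 \<and> j = 3) \<or> (i = 3 \<and> j = 1) then - 1
     else if (2 \<le> i \<and> i \<le> n - 2 \<and> j = i + 1) \<or> (2 \<le> j \<and> j \<le> n - 2 \<and> i = j + 1) then - 1
     else if i = n - 1 \<and> j = n then - 2
     else if i = n \<and> j = n - 1 then - 1
     else 0)"
| "affine_cartan_entry AffC n i j =
    (if i = j then 2
     else if i = 1 \<and> j = 2 then - 2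
     else if i = 2 \<and> j = 1 then - 1
     else if (2 \<le> i \<and> i \<le> n - 2 \<and> j = i + 1) \<or> (2 \<le> j \<and> j \<le> n - 2 \<and> i = j + 1) then - 1
     else if i = n - 1 \<and> j = n then - 1
     else if i = n \<and> j = n - 1 then - 2
     else 0)"
| "affine_cartan_entry AffD n i j =
    (if i = j then 2
     else if (i = 1 \<and> j = 3) \<or> (i = 3 \<and> j = 1) then - 1
     else if (2 \<le> i \<and> i \<le> n - 2 \<and> j = i + 1) \<or> (2 \<le> j \<and> j \<le> n - 2 \<and> i = j + 1) then - 1
     else if (i = n - 2 \<and> j = n) \<or> (i = n \<and> j = n - 2) then - 1
     else 0)"

text \<open>Rows and columns of \<^typ>\<open>int mat\<close> are numbered from 0, hence the shift.\<close>

definition affine_cartan :: "affine_type \<Rightarrow> nat \<Rightarrow> int mat" where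
  "affine_cartan X n = mat n n (\<lambda>(i, j). affine_cartan_entry X n (i + 1) (j + 1))"

definition affine_adjacency :: "affine_type \<Rightarrow> nat \<Rightarrow> int mat" where
  "affine_adjacency X n = 2 \<cdot>\<^sub>m 1\<^sub>m n - affine_cartan X n"

text \<open>The determinant is taken over \<^typ>\<open>int poly\<close>, with the integer entries
  embedded as constant polynomials.\<close>

definition affine_q :: "affine_type \<Rightarrow> nat \<Rightarrow> int poly" where
  "affine_q X n =
    det ((2 * [:0, 1:]) \<cdot>\<^sub>m 1\<^sub>m n + map_mat (\<lambda>a. [:a:]) (affine_adjacency X n))"

end

theory Submission
  imports Defs
begin

text \<open>Write \<open>x\<close> for the polynomial variable. The matrix whose determinant is \<open>q_n\<close> has \<open>2x\<close> on
  the diagonal and is otherwise the adjacency matrix of the Dynkin diagram: a cycle for type \<open>A\<close>, a path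
  with a doubled edge at each end for type \<open>C\<close>, and the same kind of path with one doubled edge
  (type \<open>B\<close>) or both of them (type \<open>D\<close>) replaced by a fork, that is, by two leaves at a common vertex.

  The determinant of a path depends on the two entries of an edge only through their product, and
  satisfies a three-term recurrence in the length, \<open>det_tridiag_Suc_Suc\<close>. With \<open>2x\<close> on the
  diagonal and products \<open>1\<close> this is the Chebyshev recurrence. A doubled edge at the start turns
  the initial values \<open>1, 2x\<close> into those of \<open>2 T_k\<close>; a doubled edge at the other end changes the
  last step of the recurrence and gives
  \<open>2 (2x T_{n-1} - 2 T_{n-2}) = 2 (T_n - T_{n-2})\<close>, which is type \<open>C\<close>
  (\<open>det_tridiag_double_ends\<close>).

  Two leaves at a common vertex are exchanged by a symmetry of the diagram. Splitting off the
  antisymmetric vector gives a factor \<open>2x\<close> and replaces the fork by a single doubled edge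
  (\<open>det_fold_twins\<close>). One fold reduces type \<open>B\<close> to a path with doubled ends on \<open>n - 1\<close> vertices:
  \<open>q_n = 2x * 2 (T_{n-1} - T_{n-3}) = 2 (T_n - T_{n-4})\<close>. Two folds reduce type \<open>D\<close> to such a path on
  \<open>n - 2\<close> vertices: \<open>q_n = 4x^2 * 2 (T_{n-2} - T_{n-4})\<close>.

  For the cycle, a permutation contributing to the determinant fixes points and swaps
  neighbours, either leaving the closing edge alone or swapping its ends, or else it goes once
  around the cycle in one of two directions (\<open>det_periodic_tridiag\<close>). The first kind gives
  the paths \<open>U_n - U_{n-2}\<close>, which is \<open>2 T_n\<close>, and the two rotations have sign \<open>(-1)^{n-1}\<close> each.\<close>

section \<open>Determinants of tridiagonal and periodic tridiagonal matrices\<close>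

definition tridiag :: "nat \<Rightarrow> (nat \<Rightarrow> 'a) \<Rightarrow> (nat \<Rightarrow> 'a) \<Rightarrow> (nat \<Rightarrow> 'a) \<Rightarrow> 'a :: zero mat" where
  "tridiag n d u l = mat n n (\<lambda>(i, j).
     if i = j then d i else if j = Suc i then u i else if i = Suc j then l j else 0)"

text \<open>The edge from the last index back to index \<open>0\<close> is treated as the step from \<open>n - 1\<close> to its
  successor, so its two entries are \<open>u (n - 1)\<close> in the lower left and \<open>l (n - 1)\<close> in the upper right
  corner. For \<open>n \<le> 2\<close> the corners would collide with the other entries.\<close>

definition periodic_tridiag :: "nat \<Rightarrow> (nat \<Rightarrow> 'a) \<Rightarrow> (nat \<Rightarrow> 'a) \<Rightarrow> (nat \<Rightarrow> 'a) \<Rightarrow> 'a :: zero mat" where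
  "periodic_tridiag n d u l = mat n n (\<lambda>(i, j).
     if i = j then d i else if j = Suc i then u i else if i = Suc j then l j
     else if Suc i = n \<and> j = 0 then u i else if i = 0 \<and> Suc j = n then l j else 0)"

lemma tridiag_carrier [simp]: "tridiag n d u l \<in> carrier_mat n n"
  by (simp add: tridiag_def)

lemma prod_list_diag_mat:
  assumes "A \<in> carrier_mat n n"
  shows "prod_list (diag_mat A) = (\<Prod>i<n. A $$ (i, i))"
  using assms by (simp add: diag_mat_def prod.list_conv_set_nth atLeast0LessThan)

text \<open>Expanding along the last row and then, in the two minors that do not delete the last
  column, along that column leaves four minors. Two are tridiagonal; the other two are
  triangular with the first \<open>m\<close> values of \<open>l\<close> or of \<open>u\<close> on the diagonal, and the two entries
  expanded along complete these to the products around the cycle.\<close>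

lemma det_periodic_tridiag:
  fixes d u l :: "nat \<Rightarrow> 'a :: comm_ring_1"
  assumes "m \<ge> 1"
  shows "det (periodic_tridiag (m + 2) d u l) =
    d (m + 1) * det (tridiag (m + 1) d u l) - u m * l m * det (tridiag m d u l)
    - u (m + 1) * l (m + 1) * det (tridiag m (\<lambda>i. d (Suc i)) (\<lambda>i. u (Suc i)) (\<lambda>i. l (Suc i)))
    + (- 1) ^ (m + 1) * ((\<Prod>i<m + 2. u i) + (\<Prod>i<m + 2. l i))"
proof -
  let ?M = "periodic_tridiag (m + 2) d u l"
  let ?S = "tridiag m (\<lambda>i. d (Suc i)) (\<lambda>i. u (Suc i)) (\<lambda>i. l (Suc i))"
  let ?A = "mat_delete ?M (m + 1) m" and ?B = "mat_delete ?M (m + 1) 0"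
  have MC: "?M \<in> carrier_mat (m + 2) (m + 2)" by (simp add: periodic_tridiag_def)
  have AC: "?A \<in> carrier_mat (m + 1) (m + 1)" and BC: "?B \<in> carrier_mat (m + 1) (m + 1)"
    using mat_delete_carrier[OF MC] by simp_all
  have row: "det ?M = ?M $$ (m + 1, 0) * cofactor ?M (m + 1) 0
      + ?M $$ (m + 1, m) * cofactor ?M (m + 1) m + ?M $$ (m + 1, m + 1) * cofactor ?M (m + 1) (m + 1)"
  proof -
    have "det ?M = (\<Sum>j<m + 2. ?M $$ (m + 1, j) * cofactor ?M (m + 1) j)"
      by (rule laplace_expansion_row[OF MC]) simp
    also have "\<dots> = (\<Sum>j\<in>{0, m, m + 1}. ?M $$ (m + 1, j) * cofactor ?M (m + 1) j)"
      by (rule sum.mono_neutral_right) (auto simp: periodic_tridiag_def)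
    finally show ?thesis using assms by simp
  qed
  have col: "det X = X $$ (0, m) * cofactor X 0 m + X $$ (m, m) * cofactor X m m"
    if X: "X \<in> carrier_mat (m + 1) (m + 1)" and Z: "\<And>i. 0 < i \<Longrightarrow> i < m \<Longrightarrow> X $$ (i, m) = 0"
    for X :: "'a mat"
  proof -
    have "det X = (\<Sum>i<m + 1. X $$ (i, m) * cofactor X i m)"
      by (rule laplace_expansion_column[OF X]) simp
    also have "\<dots> = (\<Sum>i\<in>{0, m}. X $$ (i, m) * cofactor X i m)"
      by (rule sum.mono_neutral_right) (auto simp: Z)
    finally show ?thesis using assms by simp
  qed
  have 1: "mat_delete ?M (m + 1) (m + 1) = tridiag (m + 1) d u l"
    by (rule eq_matI) (auto simp: mat_delete_def periodic_tridiag_def tridiag_def)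
  have 2: "mat_delete ?A m m = tridiag m d u l"
    by (rule eq_matI) (auto simp: mat_delete_def periodic_tridiag_def tridiag_def)
  have 3: "mat_delete ?B 0 m = ?S"
    by (rule eq_matI) (auto simp: mat_delete_def periodic_tridiag_def tridiag_def)
  \<comment> \<open>Without row \<open>0\<close> the subdiagonal becomes the diagonal.\<close>
  have 4: "det (mat_delete ?A 0 m) = (\<Prod>i<m. l i)"
  proof -
    have C: "mat_delete ?A 0 m \<in> carrier_mat m m" using mat_delete_carrier[OF AC] by simp
    have "upper_triangular (mat_delete ?A 0 m)"
      by (auto simp: mat_delete_def periodic_tridiag_def)
    from det_upper_triangular[OF this C] show ?thesis
      unfolding prod_list_diag_mat[OF C]
      by (auto simp: mat_delete_def periodic_tridiag_def elim!: trans intro!: prod.cong)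
  qed
  \<comment> \<open>Without column \<open>0\<close> the superdiagonal becomes the diagonal.\<close>
  have 5: "det (mat_delete ?B m m) = (\<Prod>i<m. u i)"
  proof -
    have C: "mat_delete ?B m m \<in> carrier_mat m m" using mat_delete_carrier[OF BC] by simp
    have "mat_delete ?B m m $$ (i, j) = 0" if "i < j" "j < m" for i j
      using that by (auto simp: mat_delete_def periodic_tridiag_def)
    from det_lower_triangular[OF this C] show ?thesis
      unfolding prod_list_diag_mat[OF C]
      by (auto simp: mat_delete_def periodic_tridiag_def elim!: trans intro!: prod.cong)
  qed
  have A: "det ?A = u m * det (tridiag m d u l) + l (m + 1) * ((- 1) ^ m * (\<Prod>i<m. l i))"
  proof -
    have "?A $$ (0, m) = l (m + 1)" "?A $$ (m, m) = u m" "\<And>i. 0 < i \<Longrightarrow> i < m \<Longrightarrow> ?A $$ (i, m) = 0"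
      using assms by (auto simp: mat_delete_def periodic_tridiag_def)
    then show ?thesis by (subst col[OF AC]) (simp_all only: cofactor_def 2 4, simp_all)
  qed
  have B: "det ?B = u m * (\<Prod>i<m. u i) + l (m + 1) * ((- 1) ^ m * det ?S)"
  proof -
    have "?B $$ (0, m) = l (m + 1)" "?B $$ (m, m) = u m" "\<And>i. 0 < i \<Longrightarrow> i < m \<Longrightarrow> ?B $$ (i, m) = 0"
      using assms by (auto simp: mat_delete_def periodic_tridiag_def)
    then show ?thesis by (subst col[OF BC]) (simp_all only: cofactor_def 3 5, simp_all)
  qed
  have sq: "(- 1) ^ m * ((- 1) ^ m * x) = (x :: 'a)" for x
    by (simp flip: mult.assoc power_add mult_2)
  have "det ?M = u (m + 1) * ((- 1) ^ (m + 1) * det ?B) - l m * det ?A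
      + d (m + 1) * det (tridiag (m + 1) d u l)"
  proof -
    have "?M $$ (m + 1, 0) = u (m + 1)" "?M $$ (m + 1, m) = l m" "?M $$ (m + 1, m + 1) = d (m + 1)"
      using assms by (auto simp: periodic_tridiag_def)
    then show ?thesis
      unfolding row cofactor_def 1 by simp
  qed
  then show ?thesis
    unfolding A B by (simp add: algebra_simps sq)
qed

text \<open>A tridiagonal matrix is a periodic one whose closing edge has both entries \<open>0\<close>; only size two,
  which is too small to be periodic, needs its own computation.\<close>

lemma det_tridiag_Suc_Suc:
  fixes d u l :: "nat \<Rightarrow> 'a :: comm_ring_1"
  shows "det (tridiag (m + 2) d u l) =
    d (m + 1) * det (tridiag (m + 1) d u l) - u m * l m * det (tridiag m d u l)"
proof (cases "m = 0")
  case True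
  have C: "tridiag 2 d u l \<in> carrier_mat 2 2" and C1: "tridiag 1 d u l \<in> carrier_mat 1 1"
    and C0: "tridiag 0 d u l \<in> carrier_mat 0 0" by simp_all
  have minor: "det (mat_delete (tridiag 2 d u l) 1 j) = (if j = 0 then u 0 else d 0)" for j
    using mat_delete_carrier[OF C, of 1 j]
    by (subst det_single) (simp_all add: mat_delete_def tridiag_def)
  have "det (tridiag 2 d u l) = (\<Sum>j\<in>{0, 1}. tridiag 2 d u l $$ (1, j) * cofactor (tridiag 2 d u l) 1 j)"
    using laplace_expansion_row[OF C, of 1] by (simp add: lessThan_atLeast0 numeral_2_eq_2)
  also have "\<dots> = d 0 * d 1 - u 0 * l 0"
    unfolding cofactor_def minor by (simp add: tridiag_def mult.commute)
  finally have "det (tridiag 2 d u l) = d 0 * d 1 - u 0 * l 0" .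
  moreover have "det (tridiag 1 d u l) = d 0"
    unfolding det_single[OF C1] by (simp add: tridiag_def)
  ultimately show ?thesis
    by (simp add: True det_dim_zero[OF C0] numeral_2_eq_2 mult.commute)
next
  case False
  define u' l' where "u' = u(m + 1 := 0)" and "l' = l(m + 1 := 0)"
  have eq: "tridiag k d u' l' = tridiag k d u l" if "k \<le> m + 2" for k
    using that by (intro eq_matI) (auto simp: tridiag_def u'_def l'_def)
  have "tridiag (m + 2) d u l = periodic_tridiag (m + 2) d u' l'"
    by (rule eq_matI) (auto simp: tridiag_def periodic_tridiag_def u'_def l'_def)
  then show ?thesis
    using det_periodic_tridiag[of m d u' l'] False
    by (simp add: eq) (simp add: u'_def l'_def)
qed

text \<open>Two rows \<open>p\<close> and \<open>q\<close> that agree outside the columns \<open>p, q\<close> and have equal sums inside them: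
  subtracting row \<open>q\<close> from row \<open>p\<close> and then adding column \<open>p\<close> to column \<open>q\<close> leaves only the diagonal
  entry in row \<open>p\<close>. For two leaves of a graph at the same vertex, the remaining minor is the
  graph without leaf \<open>p\<close>, in which the entry from that vertex to leaf \<open>q\<close> is doubled.\<close>

lemma det_fold_twins:
  fixes M :: "'a :: comm_ring_1 mat"
  assumes M: "M \<in> carrier_mat n n" and p: "p < n" and q: "q < n" and "p \<noteq> q"
    and rows: "\<And>j. j < n \<Longrightarrow> j \<noteq> p \<Longrightarrow> j \<noteq> q \<Longrightarrow> M $$ (p, j) = M $$ (q, j)"
    and block: "M $$ (p, p) + M $$ (p, q) = M $$ (q, p) + M $$ (q, q)"
  shows "det M = (M $$ (p, p) - M $$ (q, p)) * det (mat_delete (addcol 1 q p M) p p)"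
proof -
  define R where "R = addrow (- 1) p q M"
  define N where "N = addcol 1 q p R"
  have R: "R \<in> carrier_mat n n" using M by (simp add: R_def)
  have N: "N \<in> carrier_mat n n" using carrier_matD[OF R] by (intro carrier_matI) (simp_all add: N_def)
  have entry: "N $$ (p, j) = (if j = q then M $$ (p, q) - M $$ (q, q) + (M $$ (p, p) - M $$ (q, p))
      else M $$ (p, j) - M $$ (q, j))" if "j < n" for j
    using carrier_matD[OF M] p q that by (simp add: N_def R_def)
  have zero: "N $$ (p, j) = 0" if "j < n" "j \<noteq> p" for j
    using entry[OF that(1)] rows[OF that(1)] that(2) block by (cases "j = q") (simp_all add: algebra_simps)
  have "det M = det N"
    using det_addrow[OF q \<open>p \<noteq> q\<close> M, of "- 1"] det_addcol[OF p \<open>p \<noteq> q\<close>[symmetric] R, of 1]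
    by (simp add: R_def N_def)
  also have "\<dots> = (\<Sum>j<n. N $$ (p, j) * cofactor N p j)"
    by (rule laplace_expansion_row[OF N p])
  also have "\<dots> = (\<Sum>j\<in>{p}. N $$ (p, j) * cofactor N p j)"
    using p by (intro sum.mono_neutral_right) (auto simp: zero)
  also have "\<dots> = (M $$ (p, p) - M $$ (q, p)) * det (mat_delete N p p)"
    using entry[OF p] \<open>p \<noteq> q\<close> by (simp add: cofactor_def)
  also have "mat_delete N p p = mat_delete (addcol 1 q p M) p p"
    using carrier_matD[OF M] p q \<open>p \<noteq> q\<close>
    by (intro eq_matI) (simp_all add: N_def R_def mat_delete_def)
  finally show ?thesis .
qed

section \<open>Chebyshev polynomials as determinants of paths\<close>

text \<open>Unfolding the recurrence automatically would turn its factor \<open>[:0, 1:]\<close> into coefficient shifts,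
  on which ring normalisation fails; below, the variable is kept as an opaque ring element.\<close>

declare cheb_T.simps [simp del]

lemma cheb_T_rec: "cheb_T (k + 2) = 2 * [:0, 1:] * cheb_T (k + 1) - cheb_T k"
  by (metis Suc_eq_plus1 add_2_eq_Suc' cheb_T.simps(3))

lemma cheb_T_0: "cheb_T 0 = 1" and cheb_T_1: "cheb_T 1 = [:0, 1:]"
  by (simp_all add: cheb_T.simps)

text \<open>\<open>U k\<close> is the Chebyshev polynomial of the second kind, and this is the classical
  \<open>U_k - U_{k-2} = 2 T_k\<close>: both sides satisfy the same recurrence.\<close>

lemma det_tridiag_cheb_U:
  defines "U \<equiv> \<lambda>k. det (tridiag k (\<lambda>_. 2 * [:0, 1:]) (\<lambda>_. 1) (\<lambda>_. 1 :: int poly))"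
  shows "U (k + 2) - U k = 2 * cheb_T (k + 2)"
proof -
  define x :: "int poly" where "x = [:0, 1:]"
  have rec: "U (k + 2) = 2 * x * U (k + 1) - U k" for k
    unfolding U_def x_def by (subst det_tridiag_Suc_Suc) (simp only: mult_1_left mult_1_right)
  have U0: "U 0 = 1" unfolding U_def by (rule det_dim_zero) simp
  have U1: "U 1 = 2 * x"
    unfolding U_def x_def by (subst det_single) (simp_all add: tridiag_def)
  have T: "cheb_T 0 = 1" "cheb_T 1 = x" by (simp_all only: cheb_T_0 cheb_T_1 x_def)
  show ?thesis
  proof (induction k rule: induct_nat_012)
    case 0 show ?case
      using rec[of 0] U0 U1 T cheb_T_rec[of 0, folded x_def] by (simp add: numeral_2_eq_2 algebra_simps)
  next
    case 1 show ?case
    proof -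
      have U2: "U 2 = 2 * x * (2 * x) - 1" and T2: "cheb_T 2 = 2 * x * x - 1"
        using rec[of 0] U0 U1 T cheb_T_rec[of 0, folded x_def] by (simp_all add: numeral_2_eq_2)
      have U3: "U 3 = 2 * x * U 2 - U 1" and T3: "cheb_T 3 = 2 * x * cheb_T 2 - cheb_T 1"
        using rec[of 1] cheb_T_rec[of 1, folded x_def] by (simp_all add: numeral_eq_Suc)
      have "U 3 - U 1 = 2 * cheb_T 3"
        unfolding U3 T3 U2 T2 U1 T by (simp add: algebra_simps)
      then show ?thesis by (simp add: numeral_eq_Suc)
    qed
  next
    case (ge2 k)
    have "U (k + 4) - U (k + 2) = 2 * x * (U (k + 3) - U (k + 1)) - (U (k + 2) - U k)"
      using rec[of k] rec[of "k + 2"] by (simp add: numeral_eq_Suc algebra_simps)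
    also have "\<dots> = 2 * cheb_T (k + 4)"
      using ge2 cheb_T_rec[of "k + 2", folded x_def] by (simp add: numeral_eq_Suc algebra_simps)
    finally show ?case by (simp add: numeral_eq_Suc)
  qed
qed

text \<open>After the doubled first edge the leading minors of size \<open>k \<ge> 1\<close> are \<open>2 T_k\<close>; the doubled
  last edge subtracts one further \<open>2 T_n\<close> in the final step. Only the products \<open>u i * l i\<close> are
  prescribed, because folding a fork may double either of the two entries of an edge.\<close>

lemma det_tridiag_double_ends:
  fixes u l :: "nat \<Rightarrow> int poly"
  assumes "n \<ge> 1" and "u 0 * l 0 = 2" and "u n * l n = 2"
    and "\<And>i. 0 < i \<Longrightarrow> i < n \<Longrightarrow> u i * l i = 1"
  shows "det (tridiag (n + 2) (\<lambda>_. 2 * [:0, 1:]) u l) = 2 * (cheb_T (n + 2) - cheb_T n)"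
proof -
  define x :: "int poly" where "x = [:0, 1:]"
  define P where "P k = det (tridiag k (\<lambda>_. 2 * [:0, 1:]) u l)" for k
  have rec: "P (k + 2) = 2 * x * P (k + 1) - u k * l k * P k" for k
    unfolding P_def x_def by (rule det_tridiag_Suc_Suc)
  have P0: "P 0 = 1" unfolding P_def by (rule det_dim_zero) simp
  have P1: "P 1 = 2 * x" unfolding P_def x_def by (subst det_single) (simp_all add: tridiag_def)
  have T: "cheb_T 0 = 1" "cheb_T 1 = x" by (simp_all only: cheb_T_0 cheb_T_1 x_def)
  have P: "P (k + 1) = 2 * cheb_T (k + 1)" if "k \<le> n" for k
    using that
  proof (induction k rule: induct_nat_012)
    case 0 show ?case using P1 T by simp
  next
    case 1 show ?case
      using rec[of 0] P0 P1 assms(2) T cheb_T_rec[of 0, folded x_def]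
      by (simp add: numeral_2_eq_2 algebra_simps)
  next
    case (ge2 k)
    then show ?case
      using rec[of "k + 1"] assms(4)[of "k + 1"] cheb_T_rec[of "k + 1", folded x_def]
      by (simp add: numeral_2_eq_2 algebra_simps)
  qed
  have "P (n + 2) = 2 * (2 * x * cheb_T (n + 1) - cheb_T n) - 2 * cheb_T n"
    using rec[of n] P[of n] P[of "n - 1"] assms(1,3) by (simp add: algebra_simps)
  then show ?thesis
    unfolding cheb_T_rec[of n] P_def x_def by (simp only: right_diff_distrib)
qed

section \<open>The four affine types\<close>

definition affine_q_matrix :: "affine_type \<Rightarrow> nat \<Rightarrow> int poly mat" where
  "affine_q_matrix X n = mat n n (\<lambda>(i, j).
     if i = j then 2 * [:0, 1:] else [:- affine_cartan_entry X n (i + 1) (j + 1):])"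

lemma affine_q_eq_det: "affine_q X n = det (affine_q_matrix X n)"
proof -
  have [simp]: "affine_cartan_entry X n i i = 2" for i by (cases X) auto
  show ?thesis
    unfolding affine_q_def affine_q_matrix_def affine_adjacency_def affine_cartan_def
    by (intro arg_cong[where f = det] eq_matI) auto
qed

lemma affine_q_A:
  assumes "n \<ge> 3"
  shows "affine_q AffA n = 2 * (cheb_T n + (- 1) ^ (n - 1))"
proof -
  obtain m where n: "n = m + 2" and m: "m \<ge> 1"
    using that[of "n - 2"] assms by simp
  have "affine_q_matrix AffA n = periodic_tridiag (m + 2) (\<lambda>_. 2 * [:0, 1:]) (\<lambda>_. 1) (\<lambda>_. 1)"
    using m by (intro eq_matI) (auto simp: n affine_q_matrix_def periodic_tridiag_def pCons_one)
  then show ?thesis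
    using det_periodic_tridiag[OF m, of "\<lambda>_. 2 * [:0, 1:] :: int poly" "\<lambda>_. 1" "\<lambda>_. 1"]
      det_tridiag_Suc_Suc[of m "\<lambda>_. 2 * [:0, 1:] :: int poly" "\<lambda>_. 1" "\<lambda>_. 1"]
      det_tridiag_cheb_U[of m]
    by (simp add: affine_q_eq_det n del: mult_pCons_right mult_pCons_left)
qed

lemma affine_q_C:
  assumes "n \<ge> 3"
  shows "affine_q AffC n = 2 * (cheb_T n - cheb_T (n - 2))"
proof -
  obtain m where n: "n = m + 2" and m: "m \<ge> 1"
    using that[of "n - 2"] assms by simp
  have "affine_q_matrix AffC n = tridiag (m + 2) (\<lambda>_. 2 * [:0, 1:])
      (\<lambda>i. if i = 0 then 2 else 1) (\<lambda>i. if i = m then 2 else 1)"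
    using m by (intro eq_matI) (auto simp: n affine_q_matrix_def tridiag_def pCons_one numeral_poly)
  also have "det \<dots> = 2 * (cheb_T (m + 2) - cheb_T m)"
    using m by (intro det_tridiag_double_ends) auto
  finally show ?thesis by (simp add: affine_q_eq_det n)
qed

lemma affine_q_B:
  assumes "n \<ge> 4"
  shows "affine_q AffB n = 2 * (cheb_T n - cheb_T (n - 4))"
proof -
  let ?M = "affine_q_matrix AffB n"
  obtain k where n: "n = k + 4"
    using assms by (metis add.commute le_add_diff_inverse)
  have M: "?M \<in> carrier_mat n n" by (simp add: affine_q_matrix_def)
  \<comment> \<open>The indices \<open>0\<close> and \<open>1\<close> are the two leaves at index \<open>2\<close>.\<close>
  have "det ?M = (?M $$ (0, 0) - ?M $$ (1, 0)) * det (mat_delete (addcol 1 1 0 ?M) 0 0)"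
    by (rule det_fold_twins[OF M]) (auto simp: n affine_q_matrix_def)
  also have "?M $$ (0, 0) - ?M $$ (1, 0) = 2 * [:0, 1:]"
    by (simp add: n affine_q_matrix_def)
  also have "mat_delete (addcol 1 1 0 ?M) 0 0 = tridiag (k + 1 + 2) (\<lambda>_. 2 * [:0, 1:])
      (\<lambda>i. if i = k + 1 then 2 else 1) (\<lambda>i. if i = 0 then 2 else 1)"
    by (intro eq_matI) (auto simp: n affine_q_matrix_def mat_delete_def tridiag_def pCons_one numeral_poly)
  also have "det \<dots> = 2 * (cheb_T (k + 1 + 2) - cheb_T (k + 1))"
    by (rule det_tridiag_double_ends) auto
  also have "2 * [:0, 1:] * (2 * (cheb_T (k + 1 + 2) - cheb_T (k + 1))) =
      2 * (cheb_T (k + 2 + 2) - cheb_T k)"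
  proof -
    define x :: "int poly" where "x = [:0, 1:]"
    show ?thesis
      using cheb_T_rec[of k] cheb_T_rec[of "k + 1"] cheb_T_rec[of "k + 2"]
      unfolding x_def[symmetric] by (simp add: numeral_eq_Suc algebra_simps)
  qed
  finally show ?thesis by (simp add: affine_q_eq_det n numeral_eq_Suc)
qed

lemma affine_q_D:
  assumes "n \<ge> 5"
  shows "affine_q AffD n = 8 * [:0, 1:] ^ 2 * (cheb_T (n - 2) - cheb_T (n - 4))"
proof -
  let ?M = "affine_q_matrix AffD n"
  obtain k where n: "n = k + 5"
    using assms by (metis add.commute le_add_diff_inverse)
  \<comment> \<open>The diagram after the fork at the start is folded: index \<open>0\<close> carries the doubled entry, and the
    indices \<open>k + 2\<close> and \<open>k + 3\<close> are the leaves of the other fork, at index \<open>k + 1\<close>.\<close>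
  define N :: "int poly mat" where "N = mat (k + 4) (k + 4) (\<lambda>(i, j).
     if i = j then 2 * [:0, 1:] else if i = 1 \<and> j = 0 then 2
     else if j = i + 1 \<and> i \<le> k + 1 \<or> i = j + 1 \<and> j \<le> k + 1
       \<or> i = k + 1 \<and> j = k + 3 \<or> i = k + 3 \<and> j = k + 1 then 1 else 0)"
  have M: "?M \<in> carrier_mat n n" by (simp add: affine_q_matrix_def)
  have N: "N \<in> carrier_mat (k + 4) (k + 4)" by (simp add: N_def)
  have "det ?M = (?M $$ (0, 0) - ?M $$ (1, 0)) * det (mat_delete (addcol 1 1 0 ?M) 0 0)"
    by (rule det_fold_twins[OF M]) (auto simp: n affine_q_matrix_def)
  also have "?M $$ (0, 0) - ?M $$ (1, 0) = 2 * [:0, 1:]"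
    by (simp add: n affine_q_matrix_def)
  also have "mat_delete (addcol 1 1 0 ?M) 0 0 = N"
    by (intro eq_matI) (auto simp: n affine_q_matrix_def mat_delete_def N_def pCons_one numeral_poly)
  also have "det N = (N $$ (k + 3, k + 3) - N $$ (k + 2, k + 3)) *
      det (mat_delete (addcol 1 (k + 2) (k + 3) N) (k + 3) (k + 3))"
    by (rule det_fold_twins[OF N]) (auto simp: N_def)
  also have "N $$ (k + 3, k + 3) - N $$ (k + 2, k + 3) = 2 * [:0, 1:]"
    by (simp add: N_def)
  also have "mat_delete (addcol 1 (k + 2) (k + 3) N) (k + 3) (k + 3) =
      tridiag (k + 1 + 2) (\<lambda>_. 2 * [:0, 1:])
        (\<lambda>i. if i = k + 1 then 2 else 1) (\<lambda>i. if i = 0 then 2 else 1)"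
    by (intro eq_matI) (auto simp: N_def mat_delete_def tridiag_def)
  also have "det \<dots> = 2 * (cheb_T (k + 1 + 2) - cheb_T (k + 1))"
    by (rule det_tridiag_double_ends) auto
  finally show ?thesis
    by (simp add: affine_q_eq_det n power2_eq_square algebra_simps numeral_eq_Suc)
qed

theorem theorem1:
  fixes n :: nat
  shows "(n \<ge> 3 \<longrightarrow> affine_q AffA n = 2 * (cheb_T n + (- 1) ^ (n - 1)))
    \<and> (n \<ge> 4 \<longrightarrow> affine_q AffB n = 2 * (cheb_T n - cheb_T (n - 4)))
    \<and> (n \<ge> 3 \<longrightarrow> affine_q AffC n = 2 * (cheb_T n - cheb_T (n - 2)))
    \<and> (n \<ge> 5 \<longrightarrow> affine_q AffD n = 8 * [:0, 1:] ^ 2 * (cheb_T (n - 2) - cheb_T (n - 4)))"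
  using affine_q_A affine_q_B affine_q_C affine_q_D by blast

end
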